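(* Let $\emptyset\neq\mathcal{X}\subseteq\{0,1\}^n$, $\hat c\in\mathbb{R}^n_{\ge0}$, and $B=\prod_{i=1}^n[-\hat c_i,\hat c_i]$ (proportional growth). Then the variable-sized robust problem can be solved in time $T$, and the resulting set satisfies $|\mathcal{S}|=1$.
   Context: For $\lambda\ge0$ let $\mathcal{U}_\lambda=\{\hat c\}+\lambda B$ and consider $\mathsf{P}(\lambda)$: $\min_{x\in\mathcal{X}}\max_{c\in\mathcal{U}_\lambda}c^tx$. Solving the variable-sized robust problem means computing a set $\mathcal{S}\subset\mathcal{X}$ of smallest possible size such that for every $\lambda\ge0$, $\mathcal{S}$ contains an optimal solution of $\mathsf{P}(\lambda)$. $T$ denotes the time necessary to solve the nominal problem $\min\{c^tx:x\in\mathcal{X}\}$ for a given nonnegative cost vector $c$. *)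

theory Defs
  imports Jordan_Normal_Form.Matrix
begin

definition binary_vecs :: "nat \<Rightarrow> real vec set" where
  "binary_vecs n = {x \<in> carrier_vec n. \<forall>i<n. x $ i \<in> {0, 1}}"

definition nonneg_vecs :: "nat \<Rightarrow> real vec set" where
  "nonneg_vecs n = {c \<in> carrier_vec n. \<forall>i<n. 0 \<le> c $ i}"

definition uncertainty_set :: "real vec \<Rightarrow> real vec set \<Rightarrow> real \<Rightarrow> real vec set" where
  "uncertainty_set chat B l = {chat + l \<cdot>\<^sub>v b | b. b \<in> B}"

definition proportional_box :: "nat \<Rightarrow> real vec \<Rightarrow> real vec set" where
  "proportional_box n chat = {b \<in> carrier_vec n. \<forall>i<n. b $ i \<in> {- chat $ i .. chat $ i}}"

text \<open>The maximum of the linear function over the scenarios; it is attained for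
  nonempty compact \<open>U\<close>, in particular for scaled and translated boxes.\<close>

definition worst_case :: "real vec set \<Rightarrow> real vec \<Rightarrow> real" where
  "worst_case U x = (GREATEST v. v \<in> (\<lambda>c. c \<bullet> x) ` U)"

definition robust_optimal ::
  "real vec set \<Rightarrow> real vec \<Rightarrow> real vec set \<Rightarrow> real \<Rightarrow> real vec \<Rightarrow> bool" where
  "robust_optimal X chat B l x \<longleftrightarrow>
     is_arg_min (worst_case (uncertainty_set chat B l)) (\<lambda>y. y \<in> X) x"

definition covers_all_sizes ::
  "real vec set \<Rightarrow> real vec \<Rightarrow> real vec set \<Rightarrow> real vec set \<Rightarrow> bool" where
  "covers_all_sizes X chat B S \<longleftrightarrow>
     S \<subseteq> X \<and> (\<forall>l\<ge>0. \<exists>x\<in>S. robust_optimal X chat B l x)"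

text \<open>Comparing sizes by \<^const>\<open>card\<close> is adequate because \<open>X\<close>, being a set of
  0-1 vectors, is finite.\<close>

definition variable_sized_solution ::
  "real vec set \<Rightarrow> real vec \<Rightarrow> real vec set \<Rightarrow> real vec set \<Rightarrow> bool" where
  "variable_sized_solution X chat B S \<longleftrightarrow>
     covers_all_sizes X chat B S \<and>
     (\<forall>S'. covers_all_sizes X chat B S' \<longrightarrow> card S \<le> card S')"

text \<open>
  The feasible set is not an input of a program: it is accessible only through a subroutine
  that maps a cost vector \<open>c\<close> to the solution \<open>N c\<close> and runs for \<open>\<tau> c\<close> steps. What the
  subroutine does on costs with a negative entry is left open.
\<close>

definition nominal_solver ::
  "nat \<Rightarrow> real vec set \<Rightarrow> (real vec \<Rightarrow> real vec) \<Rightarrow> (real vec \<Rightarrow> nat) \<Rightarrow> nat \<Rightarrow> bool" where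
  "nominal_solver n X N \<tau> T \<longleftrightarrow>
     (\<forall>c \<in> nonneg_vecs n. is_arg_min (\<lambda>x. c \<bullet> x) (\<lambda>x. x \<in> X) (N c) \<and> \<tau> c \<le> T)"

text \<open>
  A machine has index registers, a memory of reals, and an array of solution slots. The index
  registers also serve as addresses: an operand \<open>i\<close> of a memory or slot instruction means the
  cell or slot whose number is held in index register \<open>i\<close>. A slot is empty or holds a vector.
\<close>

datatype state = State (ireg: "nat \<Rightarrow> nat") (rmem: "nat \<Rightarrow> real") (slots: "nat \<Rightarrow> real vec option")

datatype arith = Plus | Minus | Times | Divide

fun iarith :: "arith \<Rightarrow> nat \<Rightarrow> nat \<Rightarrow> nat" where
  "iarith Plus a b = a + b"
| "iarith Minus a b = a - b"
| "iarith Times a b = a * b"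
| "iarith Divide a b = a div b"

fun rarith :: "arith \<Rightarrow> real \<Rightarrow> real \<Rightarrow> real" where
  "rarith Plus a b = a + b"
| "rarith Minus a b = a - b"
| "rarith Times a b = a * b"
| "rarith Divide a b = a / b"

datatype test = ILess nat nat | RLess nat nat | Filled nat

fun holds :: "test \<Rightarrow> state \<Rightarrow> bool" where
  "holds (ILess i j) s \<longleftrightarrow> ireg s i < ireg s j"
| "holds (RLess i j) s \<longleftrightarrow> rmem s (ireg s i) < rmem s (ireg s j)"
| "holds (Filled i) s \<longleftrightarrow> slots s (ireg s i) \<noteq> None"

datatype instr =
    IConst nat nat
  | IArith arith nat nat nat
  | RConst nat int
  | RArith arith nat nat nat
  | ReadEntry nat nat nat
  | WriteEntry nat nat nat
  | ZeroSlot nat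
  | ClearSlot nat
  | Nominal nat nat

definition entry :: "real vec option \<Rightarrow> nat \<Rightarrow> real" where
  "entry v m = (case v of None \<Rightarrow> 0 | Some x \<Rightarrow> if m < dim_vec x then x $ m else 0)"

definition cost_vec :: "nat \<Rightarrow> state \<Rightarrow> nat \<Rightarrow> real vec" where
  "cost_vec n s a = vec n (\<lambda>m. rmem s (a + m))"

fun step :: "nat \<Rightarrow> (real vec \<Rightarrow> real vec) \<Rightarrow> instr \<Rightarrow> state \<Rightarrow> state" where
  "step n N (IConst i k) s = State ((ireg s)(i := k)) (rmem s) (slots s)"
| "step n N (IArith f i j k) s =
     State ((ireg s)(i := iarith f (ireg s j) (ireg s k))) (rmem s) (slots s)"
| "step n N (RConst i q) s = State (ireg s) ((rmem s)(ireg s i := of_int q)) (slots s)"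
| "step n N (RArith f i j k) s =
     State (ireg s)
       ((rmem s)(ireg s i := rarith f (rmem s (ireg s j)) (rmem s (ireg s k)))) (slots s)"
| "step n N (ReadEntry i v j) s =
     State (ireg s) ((rmem s)(ireg s i := entry (slots s (ireg s v)) (ireg s j))) (slots s)"
| "step n N (WriteEntry v j i) s =
     State (ireg s) (rmem s)
       ((slots s)(ireg s v := map_option
          (\<lambda>x. vec n (\<lambda>m. if m = ireg s j then rmem s (ireg s i) else entry (Some x) m))
          (slots s (ireg s v))))"
| "step n N (ZeroSlot v) s = State (ireg s) (rmem s) ((slots s)(ireg s v := Some (0\<^sub>v n)))"
| "step n N (ClearSlot v) s = State (ireg s) (rmem s) ((slots s)(ireg s v := None))"
| "step n N (Nominal a v) s =
     State (ireg s) (rmem s) ((slots s)(ireg s v := Some (N (cost_vec n s (ireg s a)))))"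

text \<open>The time of a subroutine call includes the transfer of its argument and result.\<close>

fun step_time :: "nat \<Rightarrow> (real vec \<Rightarrow> nat) \<Rightarrow> instr \<Rightarrow> state \<Rightarrow> nat" where
  "step_time n \<tau> (Nominal a v) s = \<tau> (cost_vec n s (ireg s a))"
| "step_time n \<tau> (ZeroSlot v) s = n + 1"
| "step_time n \<tau> _ s = 1"

datatype prog = Instr instr | Seq prog prog | IfElse test prog prog | While test prog

inductive exec ::
  "nat \<Rightarrow> (real vec \<Rightarrow> real vec) \<Rightarrow> (real vec \<Rightarrow> nat) \<Rightarrow> prog \<Rightarrow> state \<Rightarrow> state \<Rightarrow> nat \<Rightarrow> bool"
  for n N \<tau> where
  Instr: "exec n N \<tau> (Instr c) s (step n N c s) (step_time n \<tau> c s)"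
| Seq: "exec n N \<tau> P s s' t \<Longrightarrow> exec n N \<tau> Q s' s'' u \<Longrightarrow> exec n N \<tau> (Seq P Q) s s'' (t + u)"
| IfTrue: "holds b s \<Longrightarrow> exec n N \<tau> P s s' t \<Longrightarrow> exec n N \<tau> (IfElse b P Q) s s' (t + 1)"
| IfFalse: "\<not> holds b s \<Longrightarrow> exec n N \<tau> Q s s' t \<Longrightarrow> exec n N \<tau> (IfElse b P Q) s s' (t + 1)"
| WhileFalse: "\<not> holds b s \<Longrightarrow> exec n N \<tau> (While b P) s s 1"
| WhileTrue: "holds b s \<Longrightarrow> exec n N \<tau> P s s' t \<Longrightarrow> exec n N \<tau> (While b P) s' s'' u
    \<Longrightarrow> exec n N \<tau> (While b P) s s'' (t + u + 1)"

inductive_cases exec_InstrE: "exec n N \<tau> (Instr c) s s' t"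
inductive_cases exec_SeqE: "exec n N \<tau> (Seq P Q) s s' t"
inductive_cases exec_IfE: "exec n N \<tau> (IfElse b P Q) s s' t"
inductive_cases exec_WhileE: "exec n N \<tau> (While b P) s s' t"

lemma exec_deterministic:
  "exec n N \<tau> P s s' t \<Longrightarrow> exec n N \<tau> P s s'' u \<Longrightarrow> s'' = s' \<and> u = t"
proof (induction arbitrary: s'' u rule: exec.induct)
  case (Instr c s)
  then show ?case by (metis exec_InstrE)
next
  case (Seq P s s' t Q s2 v)
  from Seq.prems show ?case by (rule exec_SeqE) (auto dest!: Seq.IH)
next
  case (IfTrue b s P s' t Q)
  from IfTrue.prems show ?case by (rule exec_IfE) (auto dest!: IfTrue.IH simp: IfTrue.hyps)
next
  case (IfFalse b s Q s' t P)
  from IfFalse.prems show ?case by (rule exec_IfE) (auto dest!: IfFalse.IH simp: IfFalse.hyps)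
next
  case (WhileFalse b s P)
  from WhileFalse.prems show ?case by (rule exec_WhileE) (auto simp: WhileFalse.hyps)
next
  case (WhileTrue b s P s' t s2 v)
  from WhileTrue.prems show ?case by (rule exec_WhileE) (auto dest!: WhileTrue.IH simp: WhileTrue.hyps)
qed

text \<open>Index register 0 initially holds the dimension, and the nominal costs are stored from
  cell 0 on.\<close>

definition initial_state :: "nat \<Rightarrow> real vec \<Rightarrow> state" where
  "initial_state n chat =
     State ((\<lambda>_. 0)(0 := n)) (\<lambda>m. if m < n then chat $ m else 0) (\<lambda>_. None)"

text \<open>The output is the set of vectors held in the nonempty slots on termination.\<close>

definition computes ::
  "nat \<Rightarrow> (real vec \<Rightarrow> real vec) \<Rightarrow> (real vec \<Rightarrow> nat) \<Rightarrow> prog \<Rightarrow> real vec \<Rightarrow> real vec set \<Rightarrow> nat \<Rightarrow> bool"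
  where
  "computes n N \<tau> P chat S t \<longleftrightarrow>
     (\<exists>s. exec n N \<tau> P (initial_state n chat) s t \<and> S = ran (slots s))"

end

(* For proportional growth the worst scenario for any nonnegative x is (1 + l) chat, so the robust
   objective is a positive multiple of the nominal one for every size l. A single nominal solution
   is therefore optimal for all sizes at once. *)

theory Submission
  imports Defs
begin

text \<open>Since \<open>card\<close> is 0 on infinite sets, comparing sizes by \<open>card\<close>
  relies on this. A vector is determined by its list of entries, and only finitely many lists of a
  fixed length exist over a two-element alphabet.\<close>

lemma finite_binary_vecs: "finite (binary_vecs n)"
proof (rule finite_subset)
  show "finite (vec_of_list ` {xs. set xs \<subseteq> {0, 1 :: real} \<and> length xs = n})"
    by (intro finite_imageI finite_lists_length_eq) simp
  show "binary_vecs n \<subseteq> vec_of_list ` {xs. set xs \<subseteq> {0, 1 :: real} \<and> length xs = n}"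
  proof
    fix x assume x: "x \<in> binary_vecs n"
    have "x = vec_of_list (list_of_vec x)"
      by (simp add: vec_list)
    moreover have "set (list_of_vec x) \<subseteq> {0, 1}" "length (list_of_vec x) = n"
      using x by (auto simp: binary_vecs_def in_set_conv_nth list_of_vec_index)
    ultimately show "x \<in> vec_of_list ` {xs. set xs \<subseteq> {0, 1} \<and> length xs = n}"
      by blast
  qed
qed

lemma binary_vecs_nonneg: "binary_vecs n \<subseteq> nonneg_vecs n"
  by (force simp: binary_vecs_def nonneg_vecs_def)

lemma scalar_prod_mono_left:
  assumes "x \<in> nonneg_vecs n" "\<And>i. i < n \<Longrightarrow> b $ i \<le> c $ i"
  shows "b \<bullet> x \<le> c \<bullet> x"
  using assms by (auto simp: scalar_prod_def nonneg_vecs_def intro!: sum_mono mult_right_mono)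

lemma worst_case_proportional_box:
  assumes c: "chat \<in> nonneg_vecs n" and x: "x \<in> nonneg_vecs n" and l: "0 \<le> l"
  shows "worst_case (uncertainty_set chat (proportional_box n chat) l) x = (1 + l) * (chat \<bullet> x)"
proof -
  have carr: "chat \<in> carrier_vec n" "x \<in> carrier_vec n"
    using c x by (auto simp: nonneg_vecs_def)
  have scenario_value: "(chat + l \<cdot>\<^sub>v b) \<bullet> x = chat \<bullet> x + l * (b \<bullet> x)" if "b \<in> carrier_vec n" for b
    using carr that by (simp add: add_scalar_prod_distrib[of _ n])
  show ?thesis
    unfolding worst_case_def
  proof (rule Greatest_equality)
    \<comment> \<open>The maximum is attained at the upper corner of the box, which is
      \<open>chat\<close> itself. It lies in the box because
      \<open>- chat $ i \<le> 0 \<le> chat $ i\<close>.\<close>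
    have "chat \<in> proportional_box n chat"
      using c by (auto simp: proportional_box_def nonneg_vecs_def intro: order_trans[of _ 0])
    then have "chat + l \<cdot>\<^sub>v chat \<in> uncertainty_set chat (proportional_box n chat) l"
      by (auto simp: uncertainty_set_def)
    moreover have "(1 + l) * (chat \<bullet> x) = (chat + l \<cdot>\<^sub>v chat) \<bullet> x"
      using carr by (simp add: scenario_value distrib_right)
    ultimately show "(1 + l) * (chat \<bullet> x)
        \<in> (\<lambda>c. c \<bullet> x) ` uncertainty_set chat (proportional_box n chat) l"
      by blast
  next
    fix v
    assume "v \<in> (\<lambda>c. c \<bullet> x) ` uncertainty_set chat (proportional_box n chat) l"
    then obtain b where b: "b \<in> proportional_box n chat" "v = (chat + l \<cdot>\<^sub>v b) \<bullet> x"
      by (auto simp: uncertainty_set_def)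
    \<comment> \<open>Each \<open>b\<close> in the box is entrywise at most \<open>chat\<close>, and
      weighting by the nonnegative \<open>x\<close> preserves this.\<close>
    then have "b \<in> carrier_vec n" "b \<bullet> x \<le> chat \<bullet> x"
      using x by (auto simp: proportional_box_def intro!: scalar_prod_mono_left)
    then show "v \<le> (1 + l) * (chat \<bullet> x)"
      using b(2) l by (simp add: scenario_value distrib_right mult_left_mono)
  qed
qed

lemma robust_optimal_if_nominal_optimal:
  assumes "X \<subseteq> nonneg_vecs n" "chat \<in> nonneg_vecs n" "0 \<le> l"
    and "is_arg_min (\<lambda>x. chat \<bullet> x) (\<lambda>x. x \<in> X) x"
  shows "robust_optimal X chat (proportional_box n chat) l x"
proof -
  have "worst_case (uncertainty_set chat (proportional_box n chat) l) y = (1 + l) * (chat \<bullet> y)"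
    if "y \<in> X" for y
    using that assms by (auto intro: worst_case_proportional_box)
  \<comment> \<open>As \<open>1 + l > 0\<close>, this common factor cancels from every comparison of
    objective values.\<close>
  then show ?thesis
    using assms(3,4) by (simp add: robust_optimal_def is_arg_min_linorder)
qed

text \<open>Any covering set must serve some size, for instance \<open>l = 0\<close>, so it is
  nonempty; being a subset of the finite \<open>X\<close>, it has positive
  \<open>card\<close>.\<close>

lemma variable_sized_solution_singleton:
  assumes "finite X" "covers_all_sizes X chat B {x}"
  shows "variable_sized_solution X chat B {x}"
  unfolding variable_sized_solution_def
proof (intro conjI allI impI)
  fix S' assume "covers_all_sizes X chat B S'"
  then have "S' \<subseteq> X" "S' \<noteq> {}"
    by (auto simp: covers_all_sizes_def)
  then have "0 < card S'"
    using assms(1) by (simp add: card_gt_0_iff finite_subset)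
  then show "card {x} \<le> card S'"
    by simp
qed (rule assms(2))

(* Index register 1 is initially 0, so it addresses both cell 0, where the costs start, and slot 0. *)
lemma computes_Nominal:
  assumes "chat \<in> carrier_vec n"
  shows "computes n N \<tau> (Instr (Nominal 1 1)) chat {N chat} (\<tau> chat)"
proof -
  let ?s = "initial_state n chat"
  have cost: "cost_vec n ?s (ireg ?s 1) = chat"
    using assms by (auto simp: cost_vec_def initial_state_def)
  \<comment> \<open>All slots start empty, so only the slot filled by the call contributes to the
    output.\<close>
  have "ran (slots (step n N (Nominal 1 1) ?s)) = {N chat}"
    using cost by (auto simp: ran_def initial_state_def)
  moreover have "step_time n \<tau> (Nominal 1 1) ?s = \<tau> chat"
    using cost by simp
  ultimately show ?thesis
    unfolding computes_def by (metis exec.Instr)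
qed

theorem theorem3:
  shows "\<exists>P. \<forall>n X chat N \<tau> T.
    X \<noteq> {} \<longrightarrow> X \<subseteq> binary_vecs n \<longrightarrow> chat \<in> nonneg_vecs n \<longrightarrow> nominal_solver n X N \<tau> T \<longrightarrow>
    (\<exists>S t. computes n N \<tau> P chat S t \<and> t \<le> T \<and>
           variable_sized_solution X chat (proportional_box n chat) S \<and> card S = 1)"
proof (intro exI allI impI conjI)
  fix n X chat N \<tau> T
  assume X: "X \<subseteq> binary_vecs n" and c: "chat \<in> nonneg_vecs n"
    and solver: "nominal_solver n X N \<tau> T"
  have opt: "is_arg_min (\<lambda>x. chat \<bullet> x) (\<lambda>x. x \<in> X) (N chat)" and "\<tau> chat \<le> T"
    using solver c by (auto simp: nominal_solver_def)
  then show "\<tau> chat \<le> T"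
    by simp
  \<comment> \<open>The witness for \<open>P\<close> is a fixed program that depends on none of
    \<open>n\<close>, \<open>X\<close>, \<open>chat\<close> and \<open>N\<close>. Its running time
    is exactly that of its single call, so the bound \<open>T\<close> is met without
    overhead.\<close>
  show "computes n N \<tau> (Instr (Nominal 1 1)) chat {N chat} (\<tau> chat)"
    using c by (intro computes_Nominal) (simp add: nonneg_vecs_def)
  have "X \<subseteq> nonneg_vecs n"
    using X binary_vecs_nonneg by blast
  then have "robust_optimal X chat (proportional_box n chat) l (N chat)" if "0 \<le> l" for l
    using c opt that by (intro robust_optimal_if_nominal_optimal)
  moreover have "N chat \<in> X"
    using opt by (simp add: is_arg_min_def)
  ultimately have "covers_all_sizes X chat (proportional_box n chat) {N chat}"
    by (simp add: covers_all_sizes_def)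
  then show "variable_sized_solution X chat (proportional_box n chat) {N chat}"
    using X finite_binary_vecs by (intro variable_sized_solution_singleton) (rule finite_subset)
  show "card {N chat} = 1"
    by simp
qed

end
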